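(* Let $m\ge 1$ be an integer and let $\delta>0$. For all sufficiently large $n$ and all sufficiently small $\varepsilon>0$ (depending on $n$), consider the instance of $n+2$ independent random variables $X_1,\dots,X_{n+2}$ given by $$X_1=1,\qquad \Pr[X_i=1]=\frac{\xi_m}{n},\ \Pr[X_i=0]=1-\frac{\xi_m}{n}\ \ (2\le i\le n+1),\qquad \Pr\bigl[X_{n+2}=\tfrac1\varepsilon\bigr]=\varepsilon,\ \Pr[X_{n+2}=0]=1-\varepsilon .$$ Then every algorithm in the oracle model with $m$ oracle calls has, against an almighty adversary, competitive ratio at most $1-e^{-\xi_m}+\delta$ on this instance; that is, for every such algorithm there is an almighty adversary's choice of orderings for which the expected reward of the algorithm is at most $(1-e^{-\xi_m}+\delta)\,\mathbb{E}[\max_i X_i]$.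
   Context: $\xi_m$ denotes the unique positive solution of $1-e^{-\xi_m}=\frac{\Gamma(m+1,\xi_m)}{m!}$, where $\Gamma(m+1,x)=\int_x^\infty t^m e^{-t}\,dt$; equivalently $\sum_{k=m+1}^\infty \xi_m^k/k!=1$. Oracle model with $m$ calls: the distributions of the independent variables are known to the algorithm; the values are revealed one at a time, and the algorithm may select at most one value, irrevocably at the time it is observed. At most $m$ times, after observing the current value and before deciding on it, it may query an oracle, which answers YES if the current value is strictly larger than every value that has not yet arrived, and NO otherwise (in particular, NO in case of a tie with a later value). The reward is the selected value ($0$ if nothing is selected). Almighty adversary: it knows the algorithm (including its random decisions) and all realizations, and then chooses a permutation $\sigma$ (depending on all of these); the algorithm is shown the values in the order $X_{\sigma(1)},X_{\sigma(2)},\dots$ (it sees the values only). *)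

theory Defs
  imports "HOL-Probability.Probability" "HOL-Combinatorics.Permutations"
begin

(* The upper incomplete Gamma function Gamma(k, x), for integers k >= 1. *)
definition upper_Gamma :: "nat \<Rightarrow> real \<Rightarrow> real" where
  "upper_Gamma k x = (LBINT t:{x..}. t ^ (k - 1) * exp (- t))"

definition xi :: "nat \<Rightarrow> real" where
  "xi m = (THE x. x > 0 \<and> 1 - exp (- x) = upper_Gamma (m + 1) x / fact m)"

definition instance_pmf :: "nat \<Rightarrow> nat \<Rightarrow> real \<Rightarrow> nat \<Rightarrow> real pmf" where
  "instance_pmf m n \<epsilon> i =
    (if i = 1 then return_pmf 1
     else if i = n + 2 then map_pmf (\<lambda>b. if b then 1 / \<epsilon> else 0) (bernoulli_pmf \<epsilon>)
     else map_pmf (\<lambda>b. if b then 1 else 0) (bernoulli_pmf (xi m / real n)))"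

(* Joint law of the independent variables X 1, ..., X (n + 2); a realization is a function
   x :: nat => real that is 0 outside {1..n + 2}. *)
definition values_pmf :: "nat \<Rightarrow> nat \<Rightarrow> real \<Rightarrow> (nat \<Rightarrow> real) pmf" where
  "values_pmf m n \<epsilon> = Pi_pmf {1..n + 2} 0 (instance_pmf m n \<epsilon>)"

definition expected_max :: "nat \<Rightarrow> nat \<Rightarrow> real \<Rightarrow> real" where
  "expected_max m n \<epsilon> =
    measure_pmf.expectation (values_pmf m n \<epsilon>) (\<lambda>x. Max (x ` {1..n + 2}))"

datatype event = Value real | Answer bool

datatype action = Query | Select | Skip

(* A deterministic algorithm maps the chronological list of everything it has seen so far
   (values, the last one being the current one, and oracle answers) to its next action.  It sees
   no variable indices.  Its dependence on the known distributions is implicit: the algorithm is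
   quantified after the instance. *)
type_synonym algorithm = "event list \<Rightarrow> action"

(* Reward of A with b oracle calls left and past events h.  In observe, the list vs contains the
   values yet to arrive; in decide, v is the current value and vs the values after it.  A query
   attempted with no call left is not answered and counts as Skip, so every A :: algorithm makes at
   most b calls, and algorithms that respect the budget by themselves are unaffected. *)
fun observe :: "algorithm \<Rightarrow> nat \<Rightarrow> event list \<Rightarrow> real list \<Rightarrow> real"
  and decide :: "algorithm \<Rightarrow> nat \<Rightarrow> event list \<Rightarrow> real \<Rightarrow> real list \<Rightarrow> real" where
  "observe A b h [] = 0"
| "observe A b h (v # vs) = decide A b (h @ [Value v]) v vs"
| "decide A b h v vs =
    (case A h of
       Select \<Rightarrow> v
     | Skip \<Rightarrow> observe A b h vs
     | Query \<Rightarrow>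
        (case b of
           0 \<Rightarrow> observe A 0 h vs
         | Suc c \<Rightarrow> decide A c (h @ [Answer (\<forall>w\<in>set vs. w < v)]) v vs))"

definition reward :: "nat \<Rightarrow> algorithm \<Rightarrow> real list \<Rightarrow> real" where
  "reward m A vs = observe A m [] vs"

(* A randomized algorithm is a probability distribution on deterministic ones: all random decisions
   are drawn in advance, and each single decision is a random variable. *)
definition randomized_algorithm :: "algorithm measure \<Rightarrow> bool" where
  "randomized_algorithm M \<longleftrightarrow>
    prob_space M \<and> sets M = sets (Pi\<^sub>M UNIV (\<lambda>_. count_space UNIV))"

(* The order chosen by the almighty adversary may depend on the drawn deterministic algorithm (hence
   on all random decisions) and on the realization x. *)
definition almighty_adversary ::
  "nat \<Rightarrow> algorithm measure \<Rightarrow> (algorithm \<Rightarrow> (nat \<Rightarrow> real) \<Rightarrow> nat \<Rightarrow> nat) \<Rightarrow> bool" where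
  "almighty_adversary N M \<sigma> \<longleftrightarrow>
    (\<forall>x. (\<lambda>A. \<sigma> A x) \<in> measurable M (count_space {p. p permutes {1..N}}))"

(* The random decisions are independent of the values, so the expectation is an iterated integral.
   The inner one is over a finitely supported distribution. *)
definition expected_reward ::
  "nat \<Rightarrow> nat \<Rightarrow> real \<Rightarrow> algorithm measure \<Rightarrow> (algorithm \<Rightarrow> (nat \<Rightarrow> real) \<Rightarrow> nat \<Rightarrow> nat) \<Rightarrow> real" where
  "expected_reward m n \<epsilon> M \<sigma> =
    (\<integral>A. measure_pmf.expectation (values_pmf m n \<epsilon>)
       (\<lambda>x. reward m A (map (\<lambda>i. x (\<sigma> A x i)) [1..<n + 3])) \<partial>M)"

end

theory Submission
  imports Defs
begin

text \<open>
  The adversary presents the ones first, then \<open>1 / \<epsilon>\<close> if it occurs, then the zeros. As long as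
  every answer is NO, a deterministic algorithm behaves the same way whatever the number \<open>K\<close> of ones
  is and whether or not \<open>1 / \<epsilon>\<close> occurs. Let \<open>j\<close> be the position at which it selects a one after NO
  answers only, and \<open>Q\<close> the set of at most \<open>m\<close> positions at which it asks. If \<open>1 / \<epsilon>\<close> does not occur,
  it earns 1 only if \<open>K \<ge> j\<close> or \<open>K \<in> Q\<close>; if \<open>1 / \<epsilon>\<close> occurs, it earns more than 1 only if \<open>K < j\<close>.
  The expected reward is thus at most \<open>1 + \<epsilon> + Pr[K \<in> Q]\<close>. In the limit \<open>K - 1\<close> is Poisson with
  parameter \<open>\<xi> = xi m\<close>. The numbers \<open>\<xi>^k / k!\<close> are at least 1 for \<open>k \<le> m\<close> and at most 1 for
  \<open>k = 0\<close> and \<open>k > m\<close>, so the best \<open>Q\<close> is \<open>{2..m + 1}\<close>, whose probability is \<open>1 - 2 exp (- \<xi>)\<close> by the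
  equation defining \<open>\<xi>\<close>. The bound becomes \<open>2 (1 - exp (- \<xi>))\<close>, while the expected maximum is
  \<open>2 - \<epsilon>\<close>.
\<close>

subsection \<open>The number \<open>\<xi>\<close> and exponential tails\<close>

lemma exp_tail_sums:
  fixes x :: real
  shows "(\<lambda>k. x ^ (k + Suc m) / fact (k + Suc m)) sums (exp x - (\<Sum>k\<le>m. x ^ k / fact k))"
proof -
  have "(\<lambda>k. x ^ k / fact k) sums exp x"
    using exp_converges[of x] by (simp add: divide_inverse mult.commute)
  from sums_split_initial_segment[OF this, of "Suc m"] show ?thesis
    by (simp add: lessThan_Suc_atMost)
qed

lemma exp_tail_term_le:
  fixes x :: real
  assumes "x \<ge> 0" "k > m"
  shows "x ^ k / fact k \<le> exp x - (\<Sum>k\<le>m. x ^ k / fact k)"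
proof -
  have "x ^ ((k - Suc m) + Suc m) / fact ((k - Suc m) + Suc m) \<le>
      (\<Sum>k. x ^ (k + Suc m) / fact (k + Suc m))"
    using exp_tail_sums[of x m] assms sum_le_suminf[of "\<lambda>k. x ^ (k + Suc m) / fact (k + Suc m)" "{k - Suc m}"]
    by (simp add: sums_iff)
  with assms show ?thesis
    using exp_tail_sums[of x m] by (simp add: sums_iff)
qed

lemma exp_tail_strict_mono:
  fixes x y :: real
  assumes "0 \<le> x" "x < y"
  shows "exp x - (\<Sum>k\<le>m. x ^ k / fact k) < exp y - (\<Sum>k\<le>m. y ^ k / fact k)"
proof -
  let ?d = "\<lambda>k. y ^ (k + Suc m) / fact (k + Suc m) - x ^ (k + Suc m) / fact (k + Suc m)"
  have d: "?d sums (exp y - (\<Sum>k\<le>m. y ^ k / fact k) - (exp x - (\<Sum>k\<le>m. x ^ k / fact k)))"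
    by (intro sums_diff exp_tail_sums)
  have "?d k > 0" for k
    using assms power_strict_mono[of x y "k + Suc m"] by (simp add: divide_strict_right_mono)
  then have "suminf ?d > 0"
    using d by (intro suminf_pos) (auto simp: sums_iff)
  with d show ?thesis by (simp add: sums_iff)
qed

lemma ex1_exp_tail_eq_1: "\<exists>!x::real. x > 0 \<and> exp x - (\<Sum>k\<le>m. x ^ k / fact k) = 1"
proof (rule ex_ex1I)
  let ?T = "\<lambda>x::real. exp x - (\<Sum>k\<le>m. x ^ k / fact k)"
  let ?b = "fact (Suc m) :: real"
  have b: "?b \<ge> 1" by (rule fact_ge_1)
  \<comment> \<open>With \<open>?b\<close> equal to \<open>fact (Suc m)\<close>, this quotient is
    \<open>?b ^ m\<close>; so \<open>?b\<close> can serve as the upper end for the intermediate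
    value theorem.\<close>
  have "1 \<le> ?b ^ Suc m / fact (Suc m)"
    using b by (simp add: one_le_power del: fact_Suc)
  also have "\<dots> \<le> ?T ?b"
    using b by (intro exp_tail_term_le) auto
  finally have "1 \<le> ?T ?b" .
  moreover have T0: "?T 0 = 0"
    by (simp add: power_0_left if_distrib[of "\<lambda>x. x / _"] cong: if_cong)
  moreover have "continuous_on {0..?b} ?T"
    by (intro continuous_intros) auto
  ultimately obtain x where x: "0 \<le> x" "?T x = 1"
    using IVT'[of ?T 0 1 ?b] b by (metis fact_ge_zero zero_le_one)
  with T0 show "\<exists>x. x > 0 \<and> ?T x = 1"
    by (metis less_eq_real_def zero_neq_one)
next
  fix x y :: real
  assume "x > 0 \<and> exp x - (\<Sum>k\<le>m. x ^ k / fact k) = 1"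
    and "y > 0 \<and> exp y - (\<Sum>k\<le>m. y ^ k / fact k) = 1"
  then show "x = y"
    using exp_tail_strict_mono[of x y m] exp_tail_strict_mono[of y x m]
    by (cases x y rule: linorder_cases) auto
qed

text \<open>The negated right-hand side is an antiderivative of the integrand: differentiating the
  partial exponential sum loses exactly its last term, so by the product rule only
  \<open>t ^ m * exp (- t)\<close> remains. It vanishes at infinity.\<close>

lemma upper_Gamma_Suc:
  assumes "x \<ge> 0"
  shows "upper_Gamma (m + 1) x = fact m * exp (- x) * (\<Sum>k\<le>m. x ^ k / fact k)"
proof -
  let ?F = "\<lambda>t::real. - (fact m * exp (- t) * (\<Sum>k\<le>m. t ^ k / fact k))"
  have deriv: "(?F has_real_derivative t ^ m * exp (- t)) (at t)" for t
  proof -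
    have "((\<lambda>t. \<Sum>k\<le>m. t ^ k / fact k) has_real_derivative (\<Sum>k<m. t ^ k / fact k)) (at t)" for m and t::real
    proof (induction m)
      case (Suc m)
      have "((\<lambda>t. t ^ Suc m / fact (Suc m)) has_real_derivative t ^ m / fact m) (at t)"
        using DERIV_cdivide[OF DERIV_pow[of "Suc m" t], of "fact (Suc m)"]
        by (simp del: of_nat_Suc power_Suc)
      from DERIV_add[OF Suc this] show ?case by simp
    qed simp
    note D = this
    have S: "(\<Sum>k\<le>m. t ^ k / fact k) = (\<Sum>k<m. t ^ k / fact k) + t ^ m / fact m"
      by (simp flip: lessThan_Suc_atMost)
    show ?thesis
      by (rule derivative_eq_intros D refl | simp)+ (simp add: S field_simps)
  qed
  have lim: "(?F \<longlongrightarrow> 0) at_top"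
  proof -
    have "((\<lambda>t::real. - (fact m * (\<Sum>k\<le>m. t ^ k / exp t / fact k))) \<longlongrightarrow> - (fact m * (\<Sum>k\<le>m. 0 / fact k))) at_top"
      by (intro tendsto_intros tendsto_power_div_exp_0) auto
    then show ?thesis
      by (simp add: sum_distrib_left exp_minus field_simps)
  qed
  have "(\<integral>\<^sup>+t. ennreal (t ^ m * exp (- t)) * indicator {x..} t \<partial>lborel) = 0 - ?F x"
    using assms by (intro nn_integral_FTC_atLeast deriv lim) auto
  then have "(\<integral>\<^sup>+t. ennreal (indicator {x..} t * (t ^ m * exp (- t))) \<partial>lborel) = ennreal (- ?F x)"
    by (simp add: ennreal_mult' ennreal_indicator mult.commute)
  moreover have nonneg: "0 \<le> - ?F x"
    using assms by (simp add: sum_nonneg)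
  ultimately have "(LINT t|lborel. indicator {x..} t * (t ^ m * exp (- t))) = - ?F x"
    using assms nonneg
    by (subst integral_eq_nn_integral) (auto simp: indicator_def simp del: enn2real_ennreal intro!: enn2real_ennreal)
  then show ?thesis
    by (simp add: upper_Gamma_def set_lebesgue_integral_def)
qed

text \<open>Multiplying the defining equation by \<open>exp x\<close> turns it into "the exponential
  series after index \<open>m\<close> sums to 1". That form has exactly one positive solution, so
  the \<open>THE\<close> in \<open>xi_def\<close> is meaningful.\<close>

lemma xi_pos: "xi m > 0"
  and xi_exp_tail: "exp (xi m) - (\<Sum>k\<le>m. xi m ^ k / fact k) = 1"
proof -
  have eq: "(x > 0 \<and> 1 - exp (- x) = upper_Gamma (m + 1) x / fact m) \<longleftrightarrow>
      (x > 0 \<and> exp x - (\<Sum>k\<le>m. x ^ k / fact k) = 1)" for x :: real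
  proof (cases "x > 0")
    case True
    then have eq: "upper_Gamma (m + 1) x / fact m = exp (- x) * (\<Sum>k\<le>m. x ^ k / fact k)"
      by (subst upper_Gamma_Suc) auto
    then show ?thesis
      unfolding eq by (simp add: exp_minus field_simps)
  qed auto
  have "xi m > 0 \<and> exp (xi m) - (\<Sum>k\<le>m. xi m ^ k / fact k) = 1"
    unfolding xi_def eq by (rule theI'[OF ex1_exp_tail_eq_1])
  then show "xi m > 0" "exp (xi m) - (\<Sum>k\<le>m. xi m ^ k / fact k) = 1" by auto
qed

text \<open>This is AM-GM for the factors 1, ..., k. It converts a Poisson weight below 1 at
  \<open>k\<close> into the bound (k + 1) / 2 on the parameter.\<close>

lemma fact_le_half_power: "fact k \<le> (real (k + 1) / 2) ^ k"
proof (induction k)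
  case (Suc k)
  let ?a = "real (k + 1) / 2"
  have "2 \<le> (1 + 1 / real (k + 1)) ^ (k + 1)"
    using Bernoulli_inequality[of "1 / real (k + 1)" "k + 1"] by (simp add: field_simps)
  then have "2 * ?a ^ (k + 1) \<le> (1 + 1 / real (k + 1)) ^ (k + 1) * ?a ^ (k + 1)"
    by (intro mult_right_mono) auto
  also have "\<dots> = (real (Suc k + 1) / 2) ^ Suc k"
  proof -
    have "(1 + 1 / real (k + 1)) * ?a = real (Suc k + 1) / 2"
      by (simp add: field_simps)
    then show ?thesis
      by (metis Suc_eq_plus1 power_mult_distrib)
  qed
  finally have "2 * ?a ^ (k + 1) \<le> (real (Suc k + 1) / 2) ^ Suc k" .
  moreover have "fact (Suc k) \<le> real (k + 1) * ?a ^ k"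
    using mult_left_mono[OF Suc, of "real (k + 1)"] by (simp add: add.commute)
  moreover have "real (k + 1) * ?a ^ k = 2 * ?a ^ (k + 1)" by simp
  ultimately show ?case by linarith
qed simp

(* If the term fell below 1, then x < (k + 1) / 2, so all later ratios are at most 1/2 and the
   tail after k sums to less than 1. *)
lemma exp_term_ge_1:
  fixes x :: real
  assumes "x > 0" and tail: "exp x - (\<Sum>j\<le>m. x ^ j / fact j) = 1" and "1 \<le> k" "k \<le> m"
  shows "1 \<le> x ^ k / fact k"
proof (rule ccontr)
  assume "\<not> ?thesis"
  then have less: "x ^ k / fact k < 1" by simp
  then have "x ^ k < (real (k + 1) / 2) ^ k"
    using fact_le_half_power[of k] by (simp add: less_le_trans)
  then have x: "x < real (k + 1) / 2"
    by (rule power_less_imp_less_base) simp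
  have bound: "x ^ (i + k) / fact (i + k) \<le> x ^ k / fact k * (1 / 2) ^ i" for i
  proof (induction i)
    case (Suc i)
    have "x ^ (Suc i + k) / fact (Suc i + k) = x ^ (i + k) / fact (i + k) * (x / real (Suc (i + k)))"
      by (simp add: field_simps)
    also have "\<dots> \<le> (x ^ k / fact k * (1 / 2) ^ i) * (1 / 2)"
      using x assms(1) by (intro mult_mono Suc) (auto simp: field_simps)
    finally show ?case by simp
  qed simp
  \<comment> \<open>The tail after \<open>k\<close> starts at index k + 1, so \<open>bound\<close>
    is used at \<open>Suc i\<close> and the geometric weights 1/2, 1/4, ... add up to 1.\<close>
  have *: "(\<lambda>i. x ^ k / fact k * (1 / 2) ^ Suc i) sums (x ^ k / fact k * 1)"
    by (intro sums_mult power_half_series)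
  have "exp x - (\<Sum>j\<le>k. x ^ j / fact j) \<le> x ^ k / fact k"
    using sums_le[OF _ exp_tail_sums[of x k] *] bound[of "Suc _"] by simp
  moreover have "(\<Sum>j\<le>k. x ^ j / fact j) \<le> (\<Sum>j\<le>m. x ^ j / fact j)"
    using assms by (intro sum_mono2) auto
  ultimately show False
    using less tail by simp
qed

subsection \<open>Binomial probability of small sets\<close>

text \<open>Follows from \<open>n choose k\<close> being at most n^k / k!. The last factor is kept:
  it tends to \<open>exp (- x)\<close> for fixed \<open>k\<close>, and is bounded by 1 for large
  \<open>k\<close>.\<close>

lemma pmf_binomial_le_Poisson:
  fixes x :: real
  assumes "0 < x" "x < real n"
  shows "pmf (binomial_pmf n (x / n)) k \<le> x ^ k / fact k * (1 - x / n) ^ (n - k)"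
proof -
  have p: "x / n \<in> {0..1}" using assms by auto
  have "real (n choose k) * fact k \<le> real n ^ k"
    using binomial_fact_pow[of n k] by (metis of_nat_fact of_nat_le_iff of_nat_mult of_nat_power)
  then have "real (n choose k) * (x / n) ^ k \<le> x ^ k / fact k"
    using assms by (simp add: field_simps power_divide)
  then have "real (n choose k) * (x / n) ^ k * (1 - x / n) ^ (n - k) \<le>
      x ^ k / fact k * (1 - x / n) ^ (n - k)"
    using p by (intro mult_right_mono) auto
  then show ?thesis
    using p by simp
qed

lemma Poisson_bound_tendsto:
  fixes x :: real
  assumes "0 < x"
  shows "(\<lambda>n. x ^ k / fact k * (1 - x / real n) ^ (n - k)) \<longlonglongrightarrow> x ^ k / fact k * exp (- x)"
proof -
  have "(\<lambda>n. 1 - x / real n) \<longlonglongrightarrow> 1 - 0"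
    by (intro tendsto_intros tendsto_divide_0[OF tendsto_const] filterlim_at_top_imp_at_infinity
      filterlim_real_sequentially)
  then have "(\<lambda>n. x ^ k / fact k * ((1 + (- x) / real n) ^ n / (1 - x / real n) ^ k)) \<longlonglongrightarrow>
      x ^ k / fact k * (exp (- x) / (1 - 0) ^ k)"
    by (intro tendsto_intros tendsto_exp_limit_sequentially) auto
  then have "(\<lambda>n. x ^ k / fact k * ((1 + (- x) / real n) ^ n / (1 - x / real n) ^ k)) \<longlonglongrightarrow>
      x ^ k / fact k * exp (- x)" by simp
  moreover have "\<forall>\<^sub>F n in sequentially. x ^ k / fact k * ((1 + (- x) / real n) ^ n / (1 - x / real n) ^ k) =
      x ^ k / fact k * (1 - x / real n) ^ (n - k)"
  proof -
    have "\<forall>\<^sub>F n in sequentially. x < real n"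
      using filterlim_real_sequentially by (simp add: filterlim_at_top_dense)
    then show ?thesis
      using eventually_ge_at_top[of k]
      by eventually_elim (simp add: power_diff)
  qed
  ultimately show ?thesis
    by (rule Lim_transform_eventually)
qed

text \<open>The threshold on \<open>n\<close> must serve all \<open>Q\<close> at once, so the
  binomial weights are first bounded uniformly in \<open>k\<close> by
  \<open>exp (- x) * c k + \<eta>\<close>; then at most \<open>m\<close> such bounds are
  added.\<close>

lemma prob_binomial_small_set:
  fixes x \<delta> :: real
  assumes "x > 0" and tail: "exp x - (\<Sum>k\<le>m. x ^ k / fact k) = 1" and "\<delta> > 0"
  shows "\<forall>\<^sub>F n in sequentially. \<forall>Q. finite Q \<and> card Q \<le> m \<longrightarrow>
    measure_pmf.prob (binomial_pmf n (x / real n)) Q \<le> 1 - 2 * exp (- x) + \<delta>"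
proof -
  \<comment> \<open>Up to the factor \<open>exp (- x)\<close>, \<open>c\<close> dominates the
    Poisson weights. It is at least 1 on {1..m} and exactly 1 elsewhere, which makes {1..m} an
    optimal set of size \<open>m\<close>.\<close>
  define c where "c k = (if k \<in> {1..m} then x ^ k / fact k else 1)" for k
  define \<eta> where "\<eta> = \<delta> / real (Suc m)"
  have \<eta>: "\<eta> > 0" "real m * \<eta> \<le> \<delta>"
    using assms by (auto simp: \<eta>_def field_simps)
  have c_ge: "x ^ k / fact k \<le> c k" for k
    using exp_tail_term_le[of x m k] assms by (cases "k = 0") (auto simp: c_def)
  have c1: "1 \<le> c k" for k
    using exp_term_ge_1[OF assms(1) tail, of k] by (auto simp: c_def)
  have sum_c: "sum c Q \<le> exp x - 2" if Q: "finite Q" "card Q \<le> m" for Q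
  proof -
    \<comment> \<open>Exchange argument: each point of \<open>Q\<close> outside {1..m} contributes
      1, and is matched with a point of {1..m} missed by \<open>Q\<close>, which contributes at
      least 1.\<close>
    have "sum c (Q - {1..m}) = sum (\<lambda>_. 1) (Q - {1..m})"
      by (intro sum.cong) (auto simp: c_def)
    also have "\<dots> = real (card (Q - {1..m}))" by simp
    also have "card (Q - {1..m}) \<le> card ({1..m} - Q)"
    proof -
      have "card Q = card (Q - {1..m}) + card (Q \<inter> {1..m})"
        using Q by (metis card_Diff_subset_Int card_mono finite_Int inf_le1 le_add_diff_inverse2)
      moreover have "card {1..m} = card ({1..m} - Q) + card ({1..m} \<inter> Q)"
        by (metis card_Diff_subset_Int card_mono finite_Int finite_atLeastAtMost inf_le1 le_add_diff_inverse2)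
      ultimately show ?thesis
        using Q by (simp add: Int_commute)
    qed
    also have "real (card ({1..m} - Q)) \<le> sum c ({1..m} - Q)"
      using sum_mono[of "{1..m} - Q" "\<lambda>_. 1" c] c1 by simp
    finally have "sum c (Q - {1..m}) \<le> sum c ({1..m} - Q)" by simp
    moreover have "sum c Q = sum c (Q - {1..m}) + sum c (Q \<inter> {1..m})"
      using Q by (subst sum.union_disjoint[symmetric]) (auto intro!: sum.cong)
    moreover have "sum c {1..m} = sum c ({1..m} - Q) + sum c (Q \<inter> {1..m})"
      by (subst sum.union_disjoint[symmetric]) (auto intro!: sum.cong)
    ultimately have "sum c Q \<le> sum c {1..m}" by simp
    also have "\<dots> = (\<Sum>k\<le>m. x ^ k / fact k) - 1"
    proof -
      have "{..m} = insert 0 {1..m}" by auto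
      then show ?thesis by (simp add: c_def)
    qed
    finally show ?thesis using tail by simp
  qed
  \<comment> \<open>Beyond some \<open>N\<close> the weights are below \<open>exp (- x)\<close> even
    without the exponential factor, for every \<open>n\<close> > \<open>x\<close>. The limit in
    \<open>n\<close> is then taken for finitely many \<open>k\<close> only.\<close>
  have "(\<lambda>k. x ^ k / fact k) \<longlonglongrightarrow> 0"
    using summable_LIMSEQ_zero[OF summable_exp[of x]] by (simp add: divide_inverse mult.commute)
  then have "\<forall>\<^sub>F k in sequentially. x ^ k / fact k < exp (- x)"
    by (rule order_tendstoD) simp
  then obtain N where N: "\<And>k. k \<ge> N \<Longrightarrow> x ^ k / fact k < exp (- x)"
    by (auto simp: eventually_sequentially)
  have "\<forall>\<^sub>F n in sequentially. \<forall>k\<in>{..<N}. x ^ k / fact k * (1 - x / real n) ^ (n - k) <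
      x ^ k / fact k * exp (- x) + \<eta>"
    using \<eta> by (intro eventually_ball_finite ballI order_tendstoD(2)[OF Poisson_bound_tendsto[OF assms(1)]]) auto
  moreover have "\<forall>\<^sub>F n in sequentially. x < real n"
    using filterlim_real_sequentially by (simp add: filterlim_at_top_dense)
  ultimately show ?thesis
  proof eventually_elim
    case (elim n)
    have le: "pmf (binomial_pmf n (x / n)) k \<le> exp (- x) * c k + \<eta>" for k
    proof -
      have *: "pmf (binomial_pmf n (x / n)) k \<le> x ^ k / fact k * (1 - x / n) ^ (n - k)"
        using assms elim by (intro pmf_binomial_le_Poisson) auto
      show ?thesis
      proof (cases "k < N")
        case True
        have "x ^ k / fact k * exp (- x) \<le> exp (- x) * c k"
          unfolding mult.commute[of _ "exp (- x)"] by (intro mult_left_mono c_ge) simp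
        moreover have "x ^ k / fact k * (1 - x / n) ^ (n - k) < x ^ k / fact k * exp (- x) + \<eta>"
          using elim(1) True by blast
        ultimately show ?thesis
          using * by linarith
      next
        case False
        have "x ^ k / fact k * (1 - x / n) ^ (n - k) \<le> x ^ k / fact k * 1"
          using assms elim by (intro mult_left_mono power_le_one) auto
        also have "\<dots> \<le> exp (- x) * 1" using N[of k] False by simp
        also have "\<dots> \<le> exp (- x) * c k" using c1[of k] by (intro mult_left_mono) auto
        finally show ?thesis using * \<eta> by linarith
      qed
    qed
    show ?case
    proof (intro allI impI, elim conjE)
      fix Q :: "nat set" assume Q: "finite Q" "card Q \<le> m"
      have "measure_pmf.prob (binomial_pmf n (x / n)) Q = (\<Sum>k\<in>Q. pmf (binomial_pmf n (x / n)) k)"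
        using Q by (intro measure_measure_pmf_finite)
      also have "\<dots> \<le> (\<Sum>k\<in>Q. exp (- x) * c k + \<eta>)"
        by (intro sum_mono le)
      also have "\<dots> = exp (- x) * sum c Q + real (card Q) * \<eta>"
        by (simp add: sum.distrib sum_distrib_left)
      also have "\<dots> \<le> exp (- x) * (exp x - 2) + real m * \<eta>"
        using sum_c[OF Q] Q \<eta> by (intro add_mono mult_left_mono mult_right_mono) auto
      also have "\<dots> \<le> 1 - 2 * exp (- x) + \<delta>"
        using \<eta> by (simp add: algebra_simps flip: exp_add)
      finally show "measure_pmf.prob (binomial_pmf n (x / n)) Q \<le> 1 - 2 * exp (- x) + \<delta>" .
    qed
  qed
qed

subsection \<open>A deterministic algorithm on ones\<close>

declare decide.simps [simp del]

text \<open>A query changes only the budget and the history, so induction on the budget reduces to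
  selecting \<open>v\<close> or moving on. The bound on \<open>observe\<close> is therefore assumed
  for all budgets and histories.\<close>

lemma decide_leI:
  assumes "\<And>b h. observe A b h vs \<le> y" "v \<le> y"
  shows "decide A b h v vs \<le> y"
proof (induction b arbitrary: h)
  case 0
  with assms show ?case by (auto simp: decide.simps[of A 0] split: action.split)
next
  case (Suc b)
  with assms show ?case by (auto split: action.split simp: decide.simps[of A "Suc b"])
qed

lemma observe_le:
  assumes "0 \<le> y" "\<forall>w\<in>set vs. w \<le> y"
  shows "observe A b h vs \<le> y"
  using assms(2)
proof (induction vs arbitrary: b h)
  case (Cons v vs)
  then show ?case
    using decide_leI[of A vs y v] by simp
qed (use assms in simp)

(* Here r is the reward as a function of the values still to come.  While all answers are NO, the
   algorithm cannot tell how many ones remain.  S K says that, after NO answers only, it selects the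
   current value or one of the next K ones; Q collects the K for which it asks about the K-th of
   them (the current value if K = 0), the only question answered YES when no large value follows. *)
definition ones_bound ::
  "nat \<Rightarrow> nat \<Rightarrow> (real list \<Rightarrow> real) \<Rightarrow> nat set \<Rightarrow> (nat \<Rightarrow> bool) \<Rightarrow> bool" where
  "ones_bound b N r Q S \<longleftrightarrow> finite Q \<and> card Q \<le> b \<and>
    (\<forall>K\<le>N. \<forall>z. r (replicate K 1 @ replicate z 0) \<le> of_bool (S K) + of_bool (K \<in> Q)) \<and>
    (\<forall>K\<le>N. \<forall>z. \<forall>y>1. r (replicate K 1 @ y # replicate z 0) \<le> (if S K then 1 else y))"

text \<open>A query made at a one is answered NO whenever another one or a large value follows, so
  \<open>Q\<close> and \<open>S\<close> are inherited from the NO branch. The remaining case K = 0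
  with no large value is paid for by putting 0 into \<open>Q\<close>: one more element for one more
  call.\<close>

lemma ones_bound_decide:
  assumes "\<And>b h. \<exists>Q S. ones_bound b N (observe A b h) Q S"
  shows "\<exists>Q S. ones_bound b N (decide A b h 1) Q S"
proof (induction b arbitrary: h)
  case 0
  show ?case
  proof (cases "A h")
    case Select
    then have "ones_bound 0 N (decide A 0 h 1) {} (\<lambda>_. True)"
      by (simp add: ones_bound_def decide.simps)
    then show ?thesis by blast
  next
    case Query
    then have "decide A 0 h 1 = observe A 0 h" by (intro ext) (simp add: decide.simps)
    with assms show ?thesis by simp
  next
    case Skip
    then have "decide A 0 h 1 = observe A 0 h" by (intro ext) (simp add: decide.simps)
    with assms show ?thesis by simp
  qed
next
  case (Suc b)
  show ?case
  proof (cases "A h")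
    case Select
    then have "ones_bound (Suc b) N (decide A (Suc b) h 1) {} (\<lambda>_. True)"
      by (simp add: ones_bound_def decide.simps)
    then show ?thesis by blast
  next
    case Skip
    then have "decide A (Suc b) h 1 = observe A (Suc b) h" by (intro ext) (simp add: decide.simps)
    with assms show ?thesis by simp
  next
    case Query
    have step: "decide A (Suc b) h 1 vs = decide A b (h @ [Answer (\<forall>w\<in>set vs. w < 1)]) 1 vs" for vs
      by (subst decide.simps) (simp add: Query)
    obtain Q S where QS: "ones_bound b N (decide A b (h @ [Answer False]) 1) Q S"
      using Suc.IH[of "h @ [Answer False]"] by blast
    have "decide A (Suc b) h 1 (replicate K 1 @ replicate z 0) \<le> of_bool (S K) + of_bool (K \<in> insert 0 Q)"
      if "K \<le> N" for K z
    proof (cases "K = 0")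
      case True
      \<comment> \<open>Here the answer is YES; whatever follows, no value exceeds 1, and the term
        for \<open>0 \<in> insert 0 Q\<close> covers this.\<close>
      have "decide A (Suc b) h 1 (replicate z 0) \<le> 1"
        by (rule decide_leI, rule observe_le) auto
      with True show ?thesis by (simp add: add_increasing)
    next
      case False
      then have "decide A (Suc b) h 1 (replicate K 1 @ replicate z 0) =
          decide A b (h @ [Answer False]) 1 (replicate K 1 @ replicate z 0)"
        by (subst step) (simp add: Bex_def)
      then show ?thesis
        using QS that False unfolding ones_bound_def by simp
    qed
    moreover have "decide A (Suc b) h 1 (replicate K 1 @ y # replicate z 0) \<le> (if S K then 1 else y)"
      if "K \<le> N" "y > 1" for K z y
    proof -
      have "decide A (Suc b) h 1 (replicate K 1 @ y # replicate z 0) =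
          decide A b (h @ [Answer False]) 1 (replicate K 1 @ y # replicate z 0)"
        using that by (subst step) simp
      then show ?thesis
        using QS that unfolding ones_bound_def by simp
    qed
    ultimately have "ones_bound (Suc b) N (decide A (Suc b) h 1) (insert 0 Q) S"
      using QS unfolding ones_bound_def by (simp add: card_insert_if)
    then show ?thesis by blast
  qed
qed

text \<open>Induction on the largest possible number of ones. If a one comes next, the preceding
  lemma applies to the K - 1 ones after it; if none is left, the reward is at most 0, or at most
  \<open>y\<close> when the large value comes.\<close>

lemma ones_bound_observe: "\<exists>Q S. ones_bound b N (observe A b h) Q S"
proof (induction N arbitrary: b h)
  case 0
  have "observe A b h (replicate z 0) \<le> 0" for z
    by (rule observe_le) auto
  moreover have "observe A b h (y # replicate z 0) \<le> y" if "y > 1" for y z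
    using that by (intro observe_le) auto
  ultimately have "ones_bound b 0 (observe A b h) {} (\<lambda>_. False)"
    by (simp add: ones_bound_def del: observe.simps)
  then show ?case by blast
next
  case (Suc N)
  obtain Q S where QS: "ones_bound b N (decide A b (h @ [Value 1]) 1) Q S"
    using ones_bound_decide[OF Suc.IH] by blast
  \<comment> \<open>In \<open>decide\<close> the current one is position 0, in
    \<open>observe\<close> it is position 1; hence the shift of \<open>S\<close> and
    \<open>Q\<close> by one.\<close>
  let ?S = "\<lambda>K. K > 0 \<and> S (K - 1)"
  have "observe A b h (replicate K 1 @ replicate z 0) \<le> of_bool (?S K) + of_bool (K \<in> Suc ` Q)"
    if "K \<le> Suc N" for K z
  proof (cases K)
    case 0
    have "observe A b h (replicate z 0) \<le> 0"
      by (rule observe_le) auto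
    with 0 show ?thesis by (simp add: image_iff)
  next
    case (Suc K')
    with QS that show ?thesis
      unfolding ones_bound_def by (simp add: inj_image_mem_iff)
  qed
  moreover have "observe A b h (replicate K 1 @ y # replicate z 0) \<le> (if ?S K then 1 else y)"
    if "K \<le> Suc N" "y > 1" for K z y
  proof (cases K)
    case 0
    have "observe A b h (y # replicate z 0) \<le> y"
      using that by (intro observe_le) auto
    with 0 show ?thesis by (simp del: observe.simps)
  next
    case (Suc K')
    with QS that show ?thesis
      unfolding ones_bound_def by simp
  qed
  ultimately have "ones_bound b (Suc N) (observe A b h) (Suc ` Q) ?S"
    using QS unfolding ones_bound_def by (simp add: card_image del: observe.simps)
  then show ?case by blast
qed

subsection \<open>The adversary\<close>

text \<open>An order of indices computed from the realization alone. The middle block captures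
  \<open>1 / \<epsilon>\<close> without mentioning \<open>\<epsilon>\<close>.\<close>

definition ones_first :: "nat \<Rightarrow> (nat \<Rightarrow> real) \<Rightarrow> nat list" where
  "ones_first N x = filter (\<lambda>i. x i = 1) [1..<Suc N] @
    filter (\<lambda>i. x i \<noteq> 1 \<and> x i \<noteq> 0) [1..<Suc N] @ filter (\<lambda>i. x i = 0) [1..<Suc N]"

definition ones_first_perm :: "nat \<Rightarrow> (nat \<Rightarrow> real) \<Rightarrow> nat \<Rightarrow> nat" where
  "ones_first_perm N x i = (if i \<in> {1..N} then ones_first N x ! (i - 1) else i)"

lemma set_ones_first: "set (ones_first N x) = {1..N}"
  and distinct_ones_first: "distinct (ones_first N x)"
  and length_ones_first: "length (ones_first N x) = N"
proof -
  show *: "set (ones_first N x) = {1..N}" "distinct (ones_first N x)"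
    by (auto simp: ones_first_def)
  show "length (ones_first N x) = N"
    using distinct_card[OF *(2)] *(1) by simp
qed

lemma ones_first_perm_permutes: "ones_first_perm N x permutes {1..N}"
proof (rule bij_imp_permutes)
  have "bij_betw ((!) (ones_first N x)) {..<N} {1..N}"
    using distinct_ones_first length_ones_first set_ones_first by (intro bij_betw_nth) auto
  moreover have "bij_betw (\<lambda>i. i - 1) {1..N} {..<N}"
    by (rule bij_betwI[where g = Suc]) auto
  ultimately have "bij_betw ((!) (ones_first N x) \<circ> (\<lambda>i. i - 1)) {1..N} {1..N}"
    by (rule bij_betw_trans[rotated])
  then show "bij_betw (ones_first_perm N x) {1..N} {1..N}"
    by (rule bij_betw_cong[THEN iffD1, rotated]) (simp add: ones_first_perm_def)
qed (auto simp: ones_first_perm_def)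

lemma map_ones_first_perm:
  "map (\<lambda>i. x (ones_first_perm N x i)) [1..<Suc N] = map x (ones_first N x)"
  by (rule nth_equalityI) (auto simp: length_ones_first ones_first_perm_def simp del: upt_Suc)

text \<open>The randomness is coded by bits: \<open>b\<close> for the occurrence of the large value
  and \<open>f\<close> for the variables 2, ..., n + 1.\<close>

definition realization :: "nat \<Rightarrow> real \<Rightarrow> bool \<Rightarrow> (nat \<Rightarrow> bool) \<Rightarrow> nat \<Rightarrow> real" where
  "realization n \<epsilon> b f = (\<lambda>i. of_bool (f i))(1 := 1, n + 2 := if b then 1 / \<epsilon> else 0)"

lemma map_filter_eq_replicate:
  "map x (filter (\<lambda>i. x i = c) xs) = replicate (length (filter (\<lambda>i. x i = c) xs)) c"
  by (induction xs) auto

text \<open>The \<open>Suc\<close> counts the deterministic first variable. Since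
  \<open>\<epsilon> < 1\<close>, the large value differs from 1 and falls into the middle
  block.\<close>

lemma map_ones_first_realization:
  assumes "0 < \<epsilon>" "\<epsilon> < 1"
  shows "\<exists>z. map (realization n \<epsilon> b f) (ones_first (n + 2) (realization n \<epsilon> b f)) =
    replicate (Suc (card {i\<in>{2..Suc n}. f i})) 1 @ (if b then [1 / \<epsilon>] else []) @ replicate z 0"
proof -
  let ?x = "realization n \<epsilon> b f"
  let ?U = "[1..<Suc (n + 2)]"
  have "length (filter (\<lambda>i. ?x i = 1) ?U) = card (set (filter (\<lambda>i. ?x i = 1) ?U))"
    by (rule distinct_card[symmetric]) simp
  also have "set (filter (\<lambda>i. ?x i = 1) ?U) = insert 1 {i\<in>{2..Suc n}. f i}"
    using assms by (auto simp: realization_def simp del: upt_Suc)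
  also have "card \<dots> = Suc (card {i\<in>{2..Suc n}. f i})"
    by simp
  finally have ones: "map ?x (filter (\<lambda>i. ?x i = 1) ?U) = replicate (Suc (card {i\<in>{2..Suc n}. f i})) 1"
    by (simp only: map_filter_eq_replicate)
  have U: "?U = [1..<n + 2] @ [n + 2]" by simp
  have "filter (\<lambda>i. ?x i \<noteq> 1 \<and> ?x i \<noteq> 0) [1..<n + 2] = []"
    unfolding filter_empty_conv by (auto simp: realization_def)
  then have "map ?x (filter (\<lambda>i. ?x i \<noteq> 1 \<and> ?x i \<noteq> 0) ?U) = (if b then [1 / \<epsilon>] else [])"
    unfolding U filter_append using assms by (simp add: realization_def)
  then show ?thesis
    unfolding ones_first_def map_append ones
    by (simp only: map_filter_eq_replicate[of ?x 0]) blast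
qed

lemma Max_realization:
  assumes "0 < \<epsilon>" "\<epsilon> < 1"
  shows "Max (realization n \<epsilon> b f ` {1..n + 2}) = (if b then 1 / \<epsilon> else 1)"
proof (rule Max_eqI)
  show "(if b then 1 / \<epsilon> else 1) \<in> realization n \<epsilon> b f ` {1..n + 2}"
    by (rule image_eqI[of _ _ "if b then n + 2 else 1"]) (auto simp: realization_def)
qed (use assms in \<open>auto simp: realization_def\<close>)

subsection \<open>Expected reward\<close>

abbreviation bits_pmf :: "nat \<Rightarrow> real \<Rightarrow> (nat \<Rightarrow> bool) pmf" where
  "bits_pmf n p \<equiv> Pi_pmf {2..Suc n} False (\<lambda>_. bernoulli_pmf p)"

lemma finite_set_bits_pmf: "finite (set_pmf (bits_pmf n p))"
  by (subst set_Pi_pmf) (auto intro!: finite_PiE_dflt)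

text \<open>Splitting off index n + 2 and then index 1 from the product leaves the i.i.d. bits,
  conditioned on whether the large value occurs.\<close>

lemma values_pmf_eq:
  "values_pmf m n \<epsilon> =
    bernoulli_pmf \<epsilon> \<bind> (\<lambda>b. map_pmf (realization n \<epsilon> b) (bits_pmf n (xi m / n)))"
proof -
  have "Pi_pmf {2..Suc n} 0 (instance_pmf m n \<epsilon>) =
      Pi_pmf {2..Suc n} 0 (\<lambda>_. map_pmf (of_bool :: bool \<Rightarrow> real) (bernoulli_pmf (xi m / n)))"
    by (intro Pi_pmf_cong) (auto simp: instance_pmf_def intro!: map_pmf_cong)
  also have "\<dots> = map_pmf (\<lambda>f. of_bool \<circ> f) (bits_pmf n (xi m / n))"
    by (intro Pi_pmf_map) auto
  finally have mid: "Pi_pmf {2..Suc n} 0 (instance_pmf m n \<epsilon>) = \<dots>" .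
  have "Pi_pmf (insert 1 {2..Suc n}) 0 (instance_pmf m n \<epsilon>) =
      map_pmf (\<lambda>f. (of_bool \<circ> f)(1 := 1)) (bits_pmf n (xi m / n))"
    by (subst Pi_pmf_insert')
      (auto simp: mid instance_pmf_def map_pmf_def bind_return_pmf bind_assoc_pmf)
  moreover have "{1..n + 2} = insert (n + 2) (insert 1 {2..Suc n})" by auto
  ultimately show ?thesis
    unfolding values_pmf_def
    by (simp add: Pi_pmf_insert' instance_pmf_def map_pmf_def bind_return_pmf bind_assoc_pmf
      realization_def comp_def)
qed

lemma expectation_values_pmf:
  fixes F :: "(nat \<Rightarrow> real) \<Rightarrow> real"
  assumes "0 < \<epsilon>" "\<epsilon> < 1"
  shows "measure_pmf.expectation (values_pmf m n \<epsilon>) F =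
    \<epsilon> * measure_pmf.expectation (bits_pmf n (xi m / n)) (\<lambda>f. F (realization n \<epsilon> True f)) +
    (1 - \<epsilon>) * measure_pmf.expectation (bits_pmf n (xi m / n)) (\<lambda>f. F (realization n \<epsilon> False f))"
  unfolding values_pmf_eq using assms finite_set_bits_pmf[of n "xi m / n"]
  by (subst pmf_expectation_bind[of UNIV]) (auto simp: UNIV_bool)

lemma expected_max_eq:
  assumes "0 < \<epsilon>" "\<epsilon> < 1"
  shows "expected_max m n \<epsilon> = 2 - \<epsilon>"
  unfolding expected_max_def expectation_values_pmf[OF assms] Max_realization[OF assms]
  using assms by simp

lemma expectation_card_bits:
  fixes g :: "nat \<Rightarrow> real"
  assumes "p \<in> {0..1}"
  shows "measure_pmf.expectation (bits_pmf n p) (\<lambda>f. g (card {i\<in>{2..Suc n}. f i})) =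
    measure_pmf.expectation (binomial_pmf n p) g"
proof -
  have "binomial_pmf n p = map_pmf (\<lambda>f. card {i\<in>{2..Suc n}. f i}) (bits_pmf n p)"
    using assms by (intro binomial_pmf_altdef') auto
  then show ?thesis by simp
qed

text \<open>Let s be the probability that \<open>S\<close> holds at the random number of ones. The
  large value yields at most \<epsilon> + (1 - s), its absence at most (1 - \<epsilon>) (s + B). So
  s cancels up to a nonpositive term, and stopping early or late does not help.\<close>

lemma expectation_reward_le:
  assumes \<epsilon>: "0 < \<epsilon>" "\<epsilon> < 1" and n: "xi m < real n"
    and small: "\<And>Q. finite Q \<Longrightarrow> card Q \<le> m \<Longrightarrow>
      measure_pmf.prob (binomial_pmf n (xi m / n)) Q \<le> B"
  shows "measure_pmf.expectation (values_pmf m n \<epsilon>)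
    (\<lambda>x. reward m A (map (\<lambda>i. x (ones_first_perm (n + 2) x i)) [1..<n + 3])) \<le> 1 + \<epsilon> + B"
proof -
  let ?p = "xi m / n"
  let ?P = "measure_pmf.prob (binomial_pmf n ?p)"
  let ?E = "measure_pmf.expectation (bits_pmf n ?p)"
  let ?c = "\<lambda>f. card {i\<in>{2..Suc n}. f i}"
  let ?R = "\<lambda>x. reward m A (map (\<lambda>i. x (ones_first_perm (n + 2) x i)) [1..<n + 3])"
  have p: "?p \<in> {0..1}" using xi_pos[of m] n by auto
  have fin: "integrable (measure_pmf (bits_pmf n ?p)) g" for g :: "(nat \<Rightarrow> bool) \<Rightarrow> real"
    by (intro integrable_measure_pmf_finite finite_set_bits_pmf)
  have prob: "?E (\<lambda>f. of_bool (T (?c f))) = ?P {c. T c}" for T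
  proof -
    have "?E (\<lambda>f. of_bool (T (?c f))) = ?E (\<lambda>f. indicator {c. T c} (?c f))"
      by (intro Bochner_Integration.integral_cong) (auto simp: indicator_def)
    also have "\<dots> = ?P {c. T c}"
      by (subst expectation_card_bits[OF p]) simp
    finally show ?thesis .
  qed
  obtain Q S where "ones_bound m (n + 1) (observe A m []) Q S"
    using ones_bound_observe by blast
  then have QS: "finite Q" "card Q \<le> m"
    "\<And>K z. K \<le> n + 1 \<Longrightarrow> observe A m [] (replicate K 1 @ replicate z 0) \<le> of_bool (S K) + of_bool (K \<in> Q)"
    "\<And>K z y. K \<le> n + 1 \<Longrightarrow> y > 1 \<Longrightarrow> observe A m [] (replicate K 1 @ y # replicate z 0) \<le> (if S K then 1 else y)"
    unfolding ones_bound_def by (simp_all del: observe.simps)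
  have c_le: "Suc (?c f) \<le> n + 1" for f
  proof -
    have "?c f \<le> card {2..Suc n}" by (intro card_mono) auto
    then show ?thesis by simp
  qed
  have U: "[1..<n + 3] = [1..<Suc (n + 2)]" by (simp add: numeral_3_eq_3)
  have R: "?R x = observe A m [] (map x (ones_first (n + 2) x))" for x
    unfolding U map_ones_first_perm reward_def ..
  have "?R (realization n \<epsilon> True f) \<le> 1 + 1 / \<epsilon> * of_bool (\<not> S (Suc (?c f)))" for f
  proof -
    obtain z where "map (realization n \<epsilon> True f) (ones_first (n + 2) (realization n \<epsilon> True f)) =
        replicate (Suc (?c f)) 1 @ 1 / \<epsilon> # replicate z 0"
      using map_ones_first_realization[OF \<epsilon>, of n True f] by auto
    then have "?R (realization n \<epsilon> True f) \<le> (if S (Suc (?c f)) then 1 else 1 / \<epsilon>)"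
      unfolding R using QS(4)[OF c_le, of "1 / \<epsilon>"] \<epsilon> by (simp only:) simp
    then show ?thesis by (auto split: if_splits)
  qed
  then have "?E (\<lambda>f. ?R (realization n \<epsilon> True f)) \<le> ?E (\<lambda>f. 1 + 1 / \<epsilon> * of_bool (\<not> S (Suc (?c f))))"
    by (intro integral_mono fin)
  also have "\<dots> = 1 + 1 / \<epsilon> * ?E (\<lambda>f. of_bool (\<not> S (Suc (?c f))))"
    by (subst Bochner_Integration.integral_add[OF fin fin]) (simp del: of_bool_not_iff)
  also have "?E (\<lambda>f. of_bool (\<not> S (Suc (?c f)))) = ?P {c. \<not> S (Suc c)}"
    by (rule prob)
  also have "?P {c. \<not> S (Suc c)} = 1 - ?P {c. S (Suc c)}"
    using measure_pmf.prob_compl[of "{c. S (Suc c)}" "binomial_pmf n ?p"]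
    by (simp add: Compl_eq Compl_eq_Diff_UNIV[symmetric])
  finally have E1: "?E (\<lambda>f. ?R (realization n \<epsilon> True f)) \<le> 1 + 1 / \<epsilon> * (1 - ?P {c. S (Suc c)})" .
  have "?R (realization n \<epsilon> False f) \<le> of_bool (S (Suc (?c f))) + of_bool (Suc (?c f) \<in> Q)" for f
  proof -
    obtain z where "map (realization n \<epsilon> False f) (ones_first (n + 2) (realization n \<epsilon> False f)) =
        replicate (Suc (?c f)) 1 @ replicate z 0"
      using map_ones_first_realization[OF \<epsilon>, of n False f] by auto
    then show ?thesis
      unfolding R using QS(3)[OF c_le] by (simp only:)
  qed
  then have "?E (\<lambda>f. ?R (realization n \<epsilon> False f)) \<le>
      ?E (\<lambda>f. of_bool (S (Suc (?c f))) + of_bool (Suc (?c f) \<in> Q))"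
    by (intro integral_mono fin)
  also have "\<dots> = ?P {c. S (Suc c)} + ?P {c. Suc c \<in> Q}"
    by (subst Bochner_Integration.integral_add[OF fin fin]) (simp only: prob[of "\<lambda>c. S (Suc c)"] prob[of "\<lambda>c. Suc c \<in> Q"])
  also have "?P {c. Suc c \<in> Q} \<le> B"
  proof (rule small)
    \<comment> \<open>\<open>Q\<close> refers to all ones, the binomial count omits the first
      variable; the preimage under \<open>Suc\<close> makes the shift without increasing the
      cardinality.\<close>
    have eq: "{c. Suc c \<in> Q} = Suc -` Q" by auto
    show "finite {c. Suc c \<in> Q}" unfolding eq using QS by (intro finite_vimageI) auto
    show "card {c. Suc c \<in> Q} \<le> m"
      unfolding eq using card_vimage_inj_on_le[of Suc UNIV Q] QS by simp
  qed
  finally have E0: "?E (\<lambda>f. ?R (realization n \<epsilon> False f)) \<le> ?P {c. S (Suc c)} + B" by simp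
  have "0 \<le> B" using small[of "{}"] by simp
  have "measure_pmf.expectation (values_pmf m n \<epsilon>) ?R \<le>
      \<epsilon> * (1 + 1 / \<epsilon> * (1 - ?P {c. S (Suc c)})) + (1 - \<epsilon>) * (?P {c. S (Suc c)} + B)"
    unfolding expectation_values_pmf[OF \<epsilon>]
    using \<epsilon> by (intro add_mono mult_left_mono E0 E1) auto
  also have "\<dots> = 1 + \<epsilon> + B - \<epsilon> * (?P {c. S (Suc c)} + B)"
    using \<epsilon> by (simp add: field_simps)
  also have "\<dots> \<le> 1 + \<epsilon> + B"
    using \<epsilon> \<open>0 \<le> B\<close> by simp
  finally show ?thesis .
qed

theorem theorem3p14:
  fixes m :: nat and \<delta> :: real
  assumes "m \<ge> 1" and "\<delta> > 0"
  shows "\<forall>\<^sub>F n in sequentially. \<forall>\<^sub>F \<epsilon> in at_right 0.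
    \<forall>M. randomized_algorithm M \<longrightarrow>
      (\<exists>\<sigma>. almighty_adversary (n + 2) M \<sigma> \<and>
        expected_reward m n \<epsilon> M \<sigma> \<le> (1 - exp (- xi m) + \<delta>) * expected_max m n \<epsilon>)"
proof -
  let ?\<rho> = "1 - exp (- xi m) + \<delta>"
  have \<rho>: "?\<rho> > 0" using xi_pos[of m] \<open>\<delta> > 0\<close> by (simp add: add_pos_pos)
  have "\<forall>\<^sub>F n in sequentially. xi m < real n"
    using filterlim_real_sequentially by (simp add: filterlim_at_top_dense)
  with prob_binomial_small_set[OF xi_pos[of m] xi_exp_tail \<open>\<delta> > 0\<close>] show ?thesis
  proof eventually_elim
    case (elim n)
    \<comment> \<open>The reward bound equals 2 \<rho> - \<delta> + \<epsilon> and has to be at most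
      \<rho> (2 - \<epsilon>), which amounts to \<epsilon> (1 + \<rho>) \<le> \<delta>.\<close>
    have "((\<lambda>\<epsilon>. \<epsilon> * (1 + ?\<rho>)) \<longlongrightarrow> 0 * (1 + ?\<rho>)) (at_right 0)"
      by (intro tendsto_intros)
    then have "\<forall>\<^sub>F \<epsilon> in at_right 0. \<epsilon> * (1 + ?\<rho>) < \<delta>"
      using \<open>\<delta> > 0\<close> by (intro order_tendstoD(2)) auto
    moreover have "\<forall>\<^sub>F \<epsilon> in at_right 0. \<epsilon> \<in> {0<..<1::real}"
      by (rule eventually_at_right_real) simp
    ultimately show ?case
    proof eventually_elim
      case (elim \<epsilon>)
      then have \<epsilon>: "0 < \<epsilon>" "\<epsilon> < 1" by auto
      have small: "measure_pmf.prob (binomial_pmf n (xi m / n)) Q \<le> 1 - 2 * exp (- xi m) + \<delta>"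
        if "finite Q" "card Q \<le> m" for Q
        using \<open>\<forall>Q. finite Q \<and> card Q \<le> m \<longrightarrow> _ Q\<close> that by blast
      show ?case
      \<comment> \<open>One order serves all algorithms: it is constant in the drawn algorithm,
        which makes it measurable.\<close>
      proof (intro allI impI exI[of _ "\<lambda>_. ones_first_perm (n + 2)"] conjI)
        fix M assume "randomized_algorithm M"
        then interpret prob_space M by (simp add: randomized_algorithm_def)
        show "almighty_adversary (n + 2) M (\<lambda>_. ones_first_perm (n + 2))"
          unfolding almighty_adversary_def
          using ones_first_perm_permutes[of "n + 2"] by (intro allI measurable_const) simp
        let ?r = "\<lambda>A. measure_pmf.expectation (values_pmf m n \<epsilon>)
          (\<lambda>x. reward m A (map (\<lambda>i. x (ones_first_perm (n + 2) x i)) [1..<n + 3]))"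
        have "?r A \<le> ?\<rho> * (2 - \<epsilon>)" for A
        proof -
          have "?r A \<le> 1 + \<epsilon> + (1 - 2 * exp (- xi m) + \<delta>)"
            by (rule expectation_reward_le[OF \<epsilon> \<open>xi m < real n\<close> small])
          also have "\<dots> \<le> ?\<rho> * (2 - \<epsilon>)"
            using \<open>\<epsilon> * (1 + ?\<rho>) < \<delta>\<close> by (simp add: algebra_simps)
          finally show ?thesis .
        qed
        (* The Bochner integral of a non-integrable function is 0. *)
        then have "(\<integral>A. ?r A \<partial>M) \<le> ?\<rho> * (2 - \<epsilon>)"
          using \<rho> \<epsilon> by (cases "integrable M ?r")
            (auto intro: integral_le_const simp: not_integrable_integral_eq)
        then show "expected_reward m n \<epsilon> M (\<lambda>_. ones_first_perm (n + 2)) \<le> ?\<rho> * expected_max m n \<epsilon>"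
          by (simp add: expected_reward_def expected_max_eq[OF \<epsilon>])
      qed
    qed
  qed
qed

end
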